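(* Let $U_{n,m}$ be a uni-cyclic graph (a finite simple connected graph on $n$ vertices containing exactly one cycle, which has length $m\le n$), let $\Delta_s(U_{n,m})$ be its spanning simplicial complex, and let $k$ be a field. Then the Hilbert series of the Stanley-Reisner ring $k[\Delta_s(U_{n,m})]$ is $$H(k[\Delta_s(U_{n,m})],t)=\sum_{i=0}^{m-2}\frac{\binom{n}{i+1}t^{i+1}}{(1-t)^{i+1}}+\sum_{i=m-1}^{n-2}\frac{\left[\binom{n}{i+1}-\binom{n-m}{i-m+1}\right]t^{i+1}}{(1-t)^{i+1}}+1.$$
   Context: A spanning tree of a finite simple connected graph $G(V,E)$ is a subtree of $G$ containing every vertex of $G$; $s(G)$ is the collection of all edge sets of spanning trees of $G$. The spanning simplicial complex $\Delta_s(G)$ is the simplicial complex on the vertex set $E$ (the edges of $G$) whose facets are precisely the elements of $s(G)$. A uni-cyclic graph $U_{n,m}$ has exactly $n$ edges. For a simplicial complex $\Delta$ on a vertex set of size $n$, the Stanley-Reisner ideal $I_{\mathcal N}(\Delta)\subset S=k[x_1,\ldots,x_n]$ (one variable per vertex) is generated by the monomials corresponding to non-faces of $\Delta$, and the Stanley-Reisner ring is the standard graded algebra $k[\Delta]=S/I_{\mathcal N}(\Delta)$. The Hilbert series of a standard graded $k$-algebra $A=\bigoplus_{j\ge 0}A_j$ is $\sum_{j\ge 0}(\dim_k A_j)\,t^j$. *)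

theory Defs
  imports
    "HOL-Algebra.QuotRing"
    "HOL-Algebra.Embedded_Algebras"
    "HOL-Library.Poly_Mapping"
    "HOL-Computational_Algebra.Formal_Power_Series"
begin

section \<open>Graphs\<close>

text \<open>A graph is given by its vertex set \<open>V\<close> and its edge set \<open>E\<close>, an edge being the
  two-element set of its end points.\<close>

definition simple_graph :: "'v set \<Rightarrow> 'v set set \<Rightarrow> bool" where
  "simple_graph V E \<longleftrightarrow> finite V \<and> (\<forall>e\<in>E. e \<subseteq> V \<and> card e = 2)"

definition adjacency :: "'v set set \<Rightarrow> ('v \<times> 'v) set" where
  "adjacency E = {(u, v). {u, v} \<in> E}"

definition connected_graph :: "'v set \<Rightarrow> 'v set set \<Rightarrow> bool" where
  "connected_graph V E \<longleftrightarrow> V \<noteq> {} \<and> (\<forall>u\<in>V. \<forall>v\<in>V. (u, v) \<in> (adjacency E)\<^sup>*)"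

definition closed_walk_edges :: "'v list \<Rightarrow> 'v set set" where
  "closed_walk_edges vs = {{vs ! i, vs ! (Suc i mod length vs)} | i. i < length vs}"

text \<open>A cycle is a subgraph, and is represented by its edge set. So the closed walks that
  traverse the same cycle from different starting points or in different directions count as
  one cycle, and the length of a cycle is the cardinality of the edge set.\<close>

definition cycles :: "'v set set \<Rightarrow> 'v set set set" where
  "cycles E = {closed_walk_edges vs | vs.
     distinct vs \<and> 3 \<le> length vs \<and> closed_walk_edges vs \<subseteq> E}"

definition unicyclic_graph :: "nat \<Rightarrow> nat \<Rightarrow> 'v set \<Rightarrow> 'v set set \<Rightarrow> bool" where
  "unicyclic_graph n m V E \<longleftrightarrow>
     simple_graph V E \<and> connected_graph V E \<and> card V = n \<and> (\<exists>C. cycles E = {C} \<and> card C = m)"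

definition is_tree :: "'v set \<Rightarrow> 'v set set \<Rightarrow> bool" where
  "is_tree V T \<longleftrightarrow> simple_graph V T \<and> connected_graph V T \<and> cycles T = {}"

definition spanning_trees :: "'v set \<Rightarrow> 'v set set \<Rightarrow> 'v set set set" where
  "spanning_trees V E = {T. T \<subseteq> E \<and> is_tree V T}"


section \<open>The spanning simplicial complex\<close>

definition simplicial_complex :: "'e set \<Rightarrow> 'e set set \<Rightarrow> bool" where
  "simplicial_complex X \<Delta> \<longleftrightarrow>
     finite X \<and> (\<forall>F\<in>\<Delta>. F \<subseteq> X) \<and> (\<forall>F\<in>\<Delta>. \<forall>G. G \<subseteq> F \<longrightarrow> G \<in> \<Delta>)"

definition facets :: "'e set set \<Rightarrow> 'e set set" where
  "facets \<Delta> = {F \<in> \<Delta>. \<forall>G\<in>\<Delta>. F \<subseteq> G \<longrightarrow> F = G}"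

text \<open>Lemma \<open>facets_spanning_complex\<close> below shows that the facets are the spanning trees.\<close>

definition spanning_complex :: "'v set \<Rightarrow> 'v set set \<Rightarrow> 'v set set set" where
  "spanning_complex V E = {F. \<exists>T\<in>spanning_trees V E. F \<subseteq> T}"

lemma simplicial_complex_spanning_complex:
  assumes "simple_graph V E"
  shows "simplicial_complex E (spanning_complex V E)"
proof -
  have "E \<subseteq> Pow V" "finite V"
    using assms by (auto simp: simple_graph_def)
  then have "finite E"
    by (meson finite_Pow_iff finite_subset)
  then show ?thesis
    by (auto simp: simplicial_complex_def spanning_complex_def spanning_trees_def)
qed

lemma simple_path_exists:
  assumes "(u, v) \<in> (adjacency E)\<^sup>*"
  obtains vs where "distinct vs" "vs \<noteq> []" "hd vs = u" "last vs = v"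
    "\<And>i. Suc i < length vs \<Longrightarrow> {vs ! i, vs ! Suc i} \<in> E"
proof -
  from assms have "\<exists>vs. distinct vs \<and> vs \<noteq> [] \<and> hd vs = u \<and> last vs = v \<and>
    (\<forall>i. Suc i < length vs \<longrightarrow> {vs ! i, vs ! Suc i} \<in> E)"
  proof (induction rule: rtrancl_induct)
    case base
    show ?case by (rule exI[of _ "[u]"]) simp
  next
    case (step y z)
    then obtain vs where vs: "distinct vs" "vs \<noteq> []" "hd vs = u" "last vs = y"
      and edges: "\<And>i. Suc i < length vs \<Longrightarrow> {vs ! i, vs ! Suc i} \<in> E" by blast
    show ?case
    proof (cases "z \<in> set vs")
      case True
      then obtain k where k: "k < length vs" "vs ! k = z"
        by (auto simp: in_set_conv_nth)
      have "last (take (Suc k) vs) = z"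
        using k by (simp add: take_Suc_conv_app_nth)
      then show ?thesis
        using vs k edges
        by (intro exI[of _ "take (Suc k) vs"])
          (auto simp: hd_take)
    next
      case False
      have "{(vs @ [z]) ! i, (vs @ [z]) ! Suc i} \<in> E" if "Suc i < length (vs @ [z])" for i
      proof (cases "Suc i < length vs")
        case True
        then show ?thesis using edges[of i] by (simp add: nth_append)
      next
        case False
        then have "length vs = Suc i" using that by simp
        moreover from this have "vs ! i = y"
          using vs by (simp add: last_conv_nth)
        ultimately show ?thesis
          using step.hyps(2) by (simp add: nth_append adjacency_def)
      qed
      then show ?thesis
        using vs False by (intro exI[of _ "vs @ [z]"]) auto
    qed
  qed
  then show thesis using that by blast
qed

lemma spanning_trees_antichain:
  assumes T: "is_tree V T" and T': "is_tree V T'" and sub: "T \<subseteq> T'"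
  shows "T = T'"
proof (rule ccontr)
  assume "T \<noteq> T'"
  then obtain e where e: "e \<in> T'" "e \<notin> T" using sub by blast
  have "e \<subseteq> V" "card e = 2"
    using T' e by (auto simp: is_tree_def simple_graph_def)
  then obtain u v where uv: "e = {u, v}" "u \<noteq> v" "u \<in> V" "v \<in> V"
    by (auto simp: card_2_iff)
  then have "(u, v) \<in> (adjacency T)\<^sup>*"
    using T by (auto simp: is_tree_def connected_graph_def)
  then obtain vs where vs: "distinct vs" "vs \<noteq> []" "hd vs = u" "last vs = v"
    and edges: "\<And>i. Suc i < length vs \<Longrightarrow> {vs ! i, vs ! Suc i} \<in> T"
    using simple_path_exists by metis
  have ends: "vs ! 0 = u" "vs ! (length vs - 1) = v"
    using vs by (auto simp: hd_conv_nth last_conv_nth)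
  have "length vs \<noteq> 1" using ends uv by auto
  moreover have "length vs \<noteq> 2"
    using ends uv e edges[of 0] by auto
  moreover have "length vs \<noteq> 0" using vs by simp
  ultimately have len: "3 \<le> length vs" by linarith
  have "{vs ! i, vs ! (Suc i mod length vs)} \<in> T'" if "i < length vs" for i
  proof (cases "Suc i < length vs")
    case True
    then show ?thesis using edges[of i] sub by auto
  next
    case False
    then have "Suc i = length vs" using that by simp
    moreover from this have "i = length vs - 1" by simp
    ultimately have "vs ! i = v" "Suc i mod length vs = 0" using ends by simp_all
    then show ?thesis using ends uv e by (simp add: insert_commute)
  qed
  then have "closed_walk_edges vs \<subseteq> T'"
    by (auto simp: closed_walk_edges_def)
  then have "closed_walk_edges vs \<in> cycles T'"
    using vs len by (auto simp: cycles_def)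
  then show False using T' by (simp add: is_tree_def)
qed

lemma facets_spanning_complex: "facets (spanning_complex V E) = spanning_trees V E"
proof
  show "facets (spanning_complex V E) \<subseteq> spanning_trees V E"
    unfolding facets_def spanning_complex_def by blast
  show "spanning_trees V E \<subseteq> facets (spanning_complex V E)"
  proof
    fix T assume T: "T \<in> spanning_trees V E"
    have "T = G" if G: "G \<subseteq> T'" "T' \<in> spanning_trees V E" "T \<subseteq> G" for G T'
    proof -
      have "T = T'"
        using spanning_trees_antichain[of V T T'] T G by (auto simp: spanning_trees_def)
      then show ?thesis using G by auto
    qed
    then show "T \<in> facets (spanning_complex V E)"
      using T unfolding facets_def spanning_complex_def by blast
  qed
qed


section \<open>Polynomial rings and Stanley-Reisner rings\<close>

text \<open>Monomials are exponent vectors of finite support. The type allows all elements of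
  \<open>'x\<close> as variables; \<open>mpoly_ring X\<close> is the polynomial ring in the variables from \<open>X\<close>.\<close>

type_synonym ('x, 'k) mpoly = "('x \<Rightarrow>\<^sub>0 nat) \<Rightarrow>\<^sub>0 'k"

definition mpoly_ring :: "'x set \<Rightarrow> ('x, 'k::field) mpoly ring" where
  "mpoly_ring X =
     \<lparr>carrier = {p. \<forall>a\<in>Poly_Mapping.keys p. Poly_Mapping.keys a \<subseteq> X},
      monoid.mult = (*), one = 1, zero = 0, add = (+)\<rparr>"

lemma cring_mpoly_ring: "cring (mpoly_ring X :: ('x, 'k::field) mpoly ring)"
proof (rule cringI)
  show "abelian_group (mpoly_ring X :: ('x, 'k) mpoly ring)"
  proof (rule abelian_groupI)
    fix p :: "('x, 'k) mpoly" assume "p \<in> carrier (mpoly_ring X)"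
    then show "\<exists>q\<in>carrier (mpoly_ring X). q \<oplus>\<^bsub>mpoly_ring X\<^esub> p = \<zero>\<^bsub>mpoly_ring X\<^esub>"
      by (intro bexI[of _ "- p"]) (auto simp: mpoly_ring_def)
  next
    fix p q :: "('x, 'k) mpoly"
    assume "p \<in> carrier (mpoly_ring X)" "q \<in> carrier (mpoly_ring X)"
    then show "p \<oplus>\<^bsub>mpoly_ring X\<^esub> q \<in> carrier (mpoly_ring X)"
      using Poly_Mapping.keys_add[of p q] by (fastforce simp: mpoly_ring_def)
  qed (auto simp: mpoly_ring_def ac_simps)
  show "comm_monoid (mpoly_ring X :: ('x, 'k) mpoly ring)"
  proof (rule comm_monoidI)
    fix p q :: "('x, 'k) mpoly"
    assume pq: "p \<in> carrier (mpoly_ring X)" "q \<in> carrier (mpoly_ring X)"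
    have "Poly_Mapping.keys a \<subseteq> X" if a: "a \<in> Poly_Mapping.keys (p * q)" for a
    proof -
      obtain b c where "a = b + c" "b \<in> Poly_Mapping.keys p" "c \<in> Poly_Mapping.keys q"
        using subsetD[OF Poly_Mapping.keys_mult a] by blast
      then show ?thesis
        using pq Poly_Mapping.keys_add[of b c] unfolding mpoly_ring_def by fastforce
    qed
    then show "p \<otimes>\<^bsub>mpoly_ring X\<^esub> q \<in> carrier (mpoly_ring X)"
      by (simp add: mpoly_ring_def)
  qed (auto simp: mpoly_ring_def ac_simps)
qed (auto simp: mpoly_ring_def algebra_simps)

definition scalars :: "('x, 'k::field) mpoly set" where
  "scalars = {Poly_Mapping.single 0 c | c. True}"

definition monom_degree :: "('x \<Rightarrow>\<^sub>0 nat) \<Rightarrow> nat" where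
  "monom_degree a = (\<Sum>x\<in>Poly_Mapping.keys a. Poly_Mapping.lookup a x)"

definition homogeneous :: "'x set \<Rightarrow> nat \<Rightarrow> ('x, 'k::field) mpoly set" where
  "homogeneous X j = {p \<in> carrier (mpoly_ring X). \<forall>a\<in>Poly_Mapping.keys p. monom_degree a = j}"

definition face_monomial :: "'x set \<Rightarrow> ('x, 'k::field) mpoly" where
  "face_monomial F = (\<Prod>x\<in>F. Poly_Mapping.single (Poly_Mapping.single x 1) 1)"

definition SR_ideal :: "'x set \<Rightarrow> 'x set set \<Rightarrow> ('x, 'k::field) mpoly set" where
  "SR_ideal X \<Delta> = Idl\<^bsub>mpoly_ring X\<^esub> {face_monomial F | F. F \<subseteq> X \<and> F \<notin> \<Delta>}"

lemma face_monomial_in_carrier: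
  assumes "F \<subseteq> X"
  shows "(face_monomial F :: ('x, 'k::field) mpoly) \<in> carrier (mpoly_ring X)"
proof -
  interpret cring "mpoly_ring X :: ('x, 'k) mpoly ring" by (rule cring_mpoly_ring)
  have closed: "p * q \<in> carrier (mpoly_ring X)"
    if "p \<in> carrier (mpoly_ring X)" "q \<in> carrier (mpoly_ring X)" for p q :: "('x, 'k) mpoly"
    using m_closed[OF that] by (simp add: mpoly_ring_def)
  have one: "(1 :: ('x, 'k) mpoly) \<in> carrier (mpoly_ring X)"
    using one_closed by (simp add: mpoly_ring_def)
  show ?thesis
    unfolding face_monomial_def using assms
  proof (induction F rule: infinite_finite_induct)
    case (insert x F)
    then have "Poly_Mapping.single (Poly_Mapping.single x (1::nat)) (1::'k) \<in> carrier (mpoly_ring X)"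
      by (simp add: mpoly_ring_def)
    then show ?case using insert closed by simp
  qed (use one in auto)
qed

lemma ideal_SR_ideal: "ideal (SR_ideal X \<Delta> :: ('x, 'k::field) mpoly set) (mpoly_ring X)"
proof -
  interpret cring "mpoly_ring X :: ('x, 'k) mpoly ring" by (rule cring_mpoly_ring)
  show ?thesis
    unfolding SR_ideal_def using face_monomial_in_carrier by (intro genideal_ideal) auto
qed

definition SR_ring :: "'x set \<Rightarrow> 'x set set \<Rightarrow> ('x, 'k::field) mpoly set ring" where
  "SR_ring X \<Delta> = mpoly_ring X Quot SR_ideal X \<Delta>"

definition SR_proj :: "'x set \<Rightarrow> 'x set set \<Rightarrow> ('x, 'k::field) mpoly \<Rightarrow> ('x, 'k) mpoly set" where
  "SR_proj X \<Delta> p = SR_ideal X \<Delta> +>\<^bsub>mpoly_ring X\<^esub> p"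

text \<open>The base field \<open>k\<close> inside \<open>k[\<Delta>]\<close>, and the component of degree \<open>j\<close> of \<open>k[\<Delta>]\<close>.\<close>

definition SR_scalars :: "'x set \<Rightarrow> 'x set set \<Rightarrow> ('x, 'k::field) mpoly set set" where
  "SR_scalars X \<Delta> = SR_proj X \<Delta> ` scalars"

definition SR_component :: "'x set \<Rightarrow> 'x set set \<Rightarrow> nat \<Rightarrow> ('x, 'k::field) mpoly set set" where
  "SR_component X \<Delta> j = SR_proj X \<Delta> ` homogeneous X j"

text \<open>The Hilbert series of an algebra \<open>A\<close> over a subfield \<open>K\<close> with graded components \<open>G j\<close>.\<close>

definition hilbert_series :: "('a, 'b) ring_scheme \<Rightarrow> 'a set \<Rightarrow> (nat \<Rightarrow> 'a set) \<Rightarrow> rat fps" where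
  "hilbert_series A K G = Abs_fps (\<lambda>j. of_nat (ring.dim A K (G j)))"

text \<open>The field \<open>k\<close> is passed as a type.\<close>

definition SR_hilbert_series :: "'k::field itself \<Rightarrow> 'x set \<Rightarrow> 'x set set \<Rightarrow> rat fps" where
  "SR_hilbert_series _ X \<Delta> =
     hilbert_series (SR_ring X \<Delta> :: ('x, 'k) mpoly set ring) (SR_scalars X \<Delta>) (SR_component X \<Delta>)"

end

theory Submission
  imports Defs
begin

text \<open>The Stanley-Reisner ideal is spanned by the monomials whose support is not a face, so the
  monomials of degree \<open>j\<close> supported on a face form a basis of the component of degree \<open>j\<close>. Sorting
  them by support, each face \<open>F\<close> contributes \<open>(t / (1 - t)) ^ card F\<close> to the Hilbert series. In a
  unicyclic graph, the spanning trees are obtained by deleting one edge of the cycle \<open>C\<close>, so the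
  faces are exactly the sets of edges that do not contain \<open>C\<close>. The number of edges is \<open>n\<close>, since
  deleting an edge of \<open>C\<close> leaves a tree on \<open>n\<close> vertices.\<close>

section \<open>Trees and unicyclic graphs\<close>

lemma sym_adjacency: "sym (adjacency E)"
  by (auto simp: adjacency_def sym_def insert_commute)

lemma adjacency_insert_edge:
  "adjacency (insert {u, v} E) = insert (u, v) (insert (v, u) (adjacency E))"
  by (auto simp: adjacency_def doubleton_eq_iff)

lemma cycles_mono: "E \<subseteq> F \<Longrightarrow> cycles E \<subseteq> cycles F"
  by (auto simp: cycles_def)

text \<open>A simple path from \<open>u\<close> to \<open>v\<close> inside \<open>F\<close> is
  closed up to a cycle by the new edge.\<close>

lemma cycle_through_new_edge:
  assumes conn: "(u, v) \<in> (adjacency F)\<^sup>*" and "u \<noteq> v" and "{u, v} \<notin> F"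
  shows "cycles (insert {u, v} F) \<noteq> {}"
proof -
  obtain vs where vs: "distinct vs" "vs \<noteq> []" "hd vs = u" "last vs = v"
    and edges: "\<And>i. Suc i < length vs \<Longrightarrow> {vs ! i, vs ! Suc i} \<in> F"
    using simple_path_exists[OF conn] by metis
  have ends: "vs ! 0 = u" "vs ! (length vs - 1) = v"
    using vs by (simp_all add: hd_conv_nth last_conv_nth)
  \<comment> \<open>Length 1 would give \<open>u = v\<close>, and length 2 would put
    \<open>{u, v}\<close> into \<open>F\<close>.\<close>
  have "length vs \<noteq> 0" "length vs \<noteq> 1" "length vs \<noteq> 2"
    using vs(2) ends edges[of 0] assms by auto
  then have len: "3 \<le> length vs"
    by linarith
  have "{vs ! i, vs ! (Suc i mod length vs)} \<in> insert {u, v} F" if "i < length vs" for i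
  proof (cases "Suc i < length vs")
    case True
    then show ?thesis using edges by simp
  next
    case False
    then have "i = length vs - 1" "Suc i = length vs" using that by simp_all
    then have "vs ! i = v" "Suc i mod length vs = 0" using ends(2) by simp_all
    then show ?thesis using ends(1) by (simp add: insert_commute)
  qed
  then have "closed_walk_edges vs \<in> cycles (insert {u, v} F)"
    using vs(1) len by (auto simp: cycles_def closed_walk_edges_def)
  then show ?thesis by blast
qed

section \<open>Counting the edges of a forest through its components\<close>

definition graph_components :: "'v set \<Rightarrow> 'v set set \<Rightarrow> 'v set set" where
  "graph_components V F = (\<lambda>v. (adjacency F)\<^sup>* `` {v}) ` V"

text \<open>The new edge merges the classes \<open>A\<close> of \<open>u\<close> and
  \<open>B\<close> of \<open>v\<close>, which are distinct, into \<open>A \<union> B\<close> and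
  leaves every other class as it was.\<close>

lemma card_graph_components_insert_edge:
  assumes "finite V" "u \<in> V" "v \<in> V" and not_conn: "(u, v) \<notin> (adjacency F)\<^sup>*"
  shows "card (graph_components V F) = Suc (card (graph_components V (insert {u, v} F)))"
proof -
  define R where "R = (adjacency F)\<^sup>*"
  define R' where "R' = (adjacency (insert {u, v} F))\<^sup>*"
  define A where "A = R `` {u}"
  define B where "B = R `` {v}"
  have sym: "(x, y) \<in> R \<longleftrightarrow> (y, x) \<in> R" for x y
    unfolding R_def using sym_rtrancl[OF sym_adjacency] by (meson symD)
  have trans: "(x, y) \<in> R \<Longrightarrow> (y, z) \<in> R \<Longrightarrow> (x, z) \<in> R" for x y z
    unfolding R_def by (rule rtrancl_trans)
  have self: "w \<in> R `` {w}" for w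
    by (simp add: R_def)
  have class_eq: "R `` {x} = R `` {w}" if "w \<in> R `` {x}" for w x
    using that sym trans by blast
  have R'_iff: "(x, y) \<in> R' \<longleftrightarrow> (x, y) \<in> R \<or> (x \<in> A \<union> B \<and> y \<in> A \<union> B)" for x y
  proof -
    \<comment> \<open>This is what \<open>rtrancl_insert\<close> yields when applied twice, once for
      each orientation of the new edge. Symmetry of \<open>R\<close> then collapses it: a path that
      uses the new edge starts and ends in \<open>A \<union> B\<close>.\<close>
    have "(x, y) \<in> R' \<longleftrightarrow> (x, y) \<in> R \<or> ((x, v) \<in> R \<and> (u, y) \<in> R) \<or>
      (((x, u) \<in> R \<or> ((x, v) \<in> R \<and> (u, u) \<in> R)) \<and> ((v, y) \<in> R \<or> ((v, v) \<in> R \<and> (u, y) \<in> R)))"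
      unfolding R'_def adjacency_insert_edge rtrancl_insert R_def[symmetric] by auto
    also have "\<dots> \<longleftrightarrow> (x, y) \<in> R \<or> (x \<in> A \<union> B \<and> y \<in> A \<union> B)"
      using self sym[of x u] sym[of x v] trans[of x u y] trans[of x v y] by (auto simp: A_def B_def)
    finally show ?thesis .
  qed
  have classes: "R' `` {w} = (if w \<in> A \<union> B then A \<union> B else R `` {w})" for w
  proof (cases "w \<in> A \<union> B")
    case True
    then have "R `` {w} \<subseteq> A \<union> B" using class_eq A_def B_def by blast
    then show ?thesis using True by (auto simp: R'_iff)
  next
    case False
    then show ?thesis by (auto simp: R'_iff)
  qed
  have AB: "A \<noteq> B"
    using not_conn self[of v] by (auto simp: A_def B_def R_def)
  let ?K = "(\<lambda>w. R `` {w}) ` V"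
  have in_K: "A \<in> ?K" "B \<in> ?K"
    using assms by (auto simp: A_def B_def)
  have new: "(\<lambda>w. R' `` {w}) ` V = insert (A \<union> B) (?K - {A, B})"
  proof (intro equalityI subsetI)
    fix c assume "c \<in> (\<lambda>w. R' `` {w}) ` V"
    then obtain w where w: "w \<in> V" "c = R' `` {w}" by blast
    show "c \<in> insert (A \<union> B) (?K - {A, B})"
      using w self[of w] by (auto simp: classes)
  next
    fix c assume "c \<in> insert (A \<union> B) (?K - {A, B})"
    then consider "c = A \<union> B" | w where "w \<in> V" "c = R `` {w}" "c \<noteq> A" "c \<noteq> B" by blast
    then show "c \<in> (\<lambda>w. R' `` {w}) ` V"
    proof cases
      case 1
      then have "c = R' `` {u}" using self[of u] by (simp add: classes A_def)
      then show ?thesis using assms by blast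
    next
      case 2
      then have "w \<notin> A \<union> B" using class_eq by (auto simp: A_def B_def)
      then have "c = R' `` {w}" using 2 by (simp add: classes)
      then show ?thesis using 2 by blast
    qed
  qed
  \<comment> \<open>An old class equal to \<open>A \<union> B\<close> would contain \<open>u\<close>
    and hence be \<open>A\<close>, which has been removed.\<close>
  have fresh: "A \<union> B \<notin> ?K - {A, B}"
  proof
    assume "A \<union> B \<in> ?K - {A, B}"
    then obtain w where w: "A \<union> B = R `` {w}" "A \<union> B \<noteq> A" by blast
    then have "u \<in> R `` {w}" using self[of u] by (auto simp: A_def)
    then show False using class_eq w by (simp add: A_def)
  qed
  have fin: "finite ?K" using assms by simp
  have "card ?K = card (?K - {A, B}) + 2"
    using card_Diff_subset[of "{A, B}" ?K] card_mono[OF fin, of "{A, B}"] in_K AB by simp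
  then show ?thesis
    using fresh fin unfolding graph_components_def R_def[symmetric] R'_def[symmetric] new by simp
qed

text \<open>Insert the edges one at a time. An edge inside one component would close a cycle, so
  each edge joins two components and lowers their number by one.\<close>

lemma forest_card_components:
  assumes "simple_graph V F" "cycles F = {}"
  shows "card (graph_components V F) + card F = card V"
proof -
  have fin: "finite V" and "F \<subseteq> Pow V"
    using assms by (auto simp: simple_graph_def)
  then have "finite F" by (meson finite_Pow_iff finite_subset)
  then show ?thesis using assms
  proof (induction F)
    case empty
    \<comment> \<open>The closure is reflexive, so without edges every vertex is a component of its
      own.\<close>
    have "graph_components V {} = (\<lambda>v. {v}) ` V"
      by (simp add: graph_components_def adjacency_def)
    then show ?case by (simp add: card_image)
  next
    case (insert e F)
    have "e \<subseteq> V" "card e = 2"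
      using insert.prems by (auto simp: simple_graph_def)
    then obtain u v where uv: "e = {u, v}" "u \<noteq> v" "u \<in> V" "v \<in> V"
      by (auto simp: card_2_iff)
    have "(u, v) \<notin> (adjacency F)\<^sup>*"
      using cycle_through_new_edge[of u v F] insert uv by auto
    then have "card (graph_components V F) = Suc (card (graph_components V (insert e F)))"
      using card_graph_components_insert_edge fin uv by metis
    moreover have "card (graph_components V F) + card F = card V"
      using insert cycles_mono[of F "insert e F"] by (intro insert.IH) (auto simp: simple_graph_def)
    ultimately show ?case using insert by simp
  qed
qed

lemma card_graph_components_connected:
  assumes "connected_graph V F"
  shows "card (graph_components V F) = 1"
proof -
  obtain v where v: "v \<in> V" using assms by (auto simp: connected_graph_def)
  have "(adjacency F)\<^sup>* `` {w} = (adjacency F)\<^sup>* `` {v}" if "w \<in> V" for w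
    using assms v that by (auto simp: connected_graph_def intro: rtrancl_trans)
  then have "graph_components V F = (\<lambda>_. (adjacency F)\<^sup>* `` {v}) ` V"
    unfolding graph_components_def by (intro image_cong refl)
  also have "\<dots> = {(adjacency F)\<^sup>* `` {v}}"
    using v by blast
  finally show ?thesis by simp
qed

corollary tree_card_edges:
  assumes "is_tree V T"
  shows "Suc (card T) = card V"
  using assms forest_card_components[of V T] card_graph_components_connected[of V T]
  by (simp add: is_tree_def)

section \<open>Deleting an edge of a cycle\<close>

text \<open>Since the vertices are distinct, two positions \<open>i\<close> and \<open>j\<close>
  with the same edge either agree or traverse it in opposite directions. In the latter case each is
  the cyclic successor of the other, which a length of at least 3 rules out.\<close>

lemma inj_on_closed_walk_edges:
  assumes "distinct vs" "3 \<le> length vs"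
  shows "inj_on (\<lambda>i. {vs ! i, vs ! (Suc i mod length vs)}) {..<length vs}"
proof (rule inj_onI)
  fix i j assume ij: "i \<in> {..<length vs}" "j \<in> {..<length vs}"
    and eq: "{vs ! i, vs ! (Suc i mod length vs)} = {vs ! j, vs ! (Suc j mod length vs)}"
  have l: "i < length vs" "j < length vs" "Suc i mod length vs < length vs" "Suc j mod length vs < length vs"
    using ij by (auto intro: mod_less_divisor)
  then have "i = j \<or> (i = Suc j mod length vs \<and> Suc i mod length vs = j)"
    using eq assms(1) unfolding doubleton_eq_iff by (metis nth_eq_iff_index_eq)
  moreover have "Suc i mod length vs \<noteq> j" if "i = Suc j mod length vs"
  proof
    assume j: "Suc i mod length vs = j"
    consider "Suc j < length vs" | "Suc j = length vs" using l by linarith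
    then show False
    proof cases
      case 1
      then have "i = Suc j" using that by simp
      then show False using j l assms(2) by (cases "Suc i < length vs") (auto simp: not_less le_Suc_eq)
    next
      case 2
      then have "i = 0" using that by simp
      then show False using 2 j assms(2) by simp
    qed
  qed
  ultimately show "i = j" by blast
qed

lemma card_closed_walk_edges:
  assumes "distinct vs" "3 \<le> length vs"
  shows "card (closed_walk_edges vs) = length vs"
proof -
  have "closed_walk_edges vs = (\<lambda>i. {vs ! i, vs ! (Suc i mod length vs)}) ` {..<length vs}"
    by (auto simp: closed_walk_edges_def)
  then show ?thesis using inj_on_closed_walk_edges[OF assms] by (simp add: card_image)
qed

text \<open>The rest of the cycle is a detour between the end points of \<open>e\<close>, so any
  walk in \<open>E\<close> can be rerouted around \<open>e\<close>.\<close>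

lemma connected_graph_delete_cycle_edge:
  assumes conn: "connected_graph V E" and "C \<in> cycles E" and "e \<in> C"
  shows "connected_graph V (E - {e})"
proof -
  obtain vs where vs: "distinct vs" "3 \<le> length vs" "closed_walk_edges vs \<subseteq> E"
    and C: "C = closed_walk_edges vs"
    using assms(2) by (auto simp: cycles_def)
  let ?l = "length vs"
  obtain i where i: "i < ?l" and e: "e = {vs ! i, vs ! (Suc i mod ?l)}"
    using assms(3) by (auto simp: C closed_walk_edges_def)
  let ?R = "(adjacency (E - {e}))\<^sup>*"
  \<comment> \<open>The detour leaves from the far end of \<open>e\<close> and goes on around the
    cycle. It reaches \<open>vs ! i\<close>, the other end, at \<open>k = length vs - 1\<close>, and
    before that it never stands at position \<open>i\<close>, where the edge \<open>e\<close> would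
    be taken.\<close>
  have walk: "(vs ! (Suc i mod ?l), vs ! ((Suc i + k) mod ?l)) \<in> ?R" if "k < ?l" for k
    using that
  proof (induction k)
    case 0
    then show ?case by simp
  next
    case (Suc k)
    let ?j = "(Suc i + k) mod ?l"
    have j: "?j < ?l" using i by (intro mod_less_divisor) auto
    \<comment> \<open>Before wrapping around, the position exceeds \<open>i\<close>; afterwards it
      is \<open>Suc i + k - length vs\<close>, which is below \<open>i\<close> because
      \<open>Suc k < length vs\<close>.\<close>
    have "?j \<noteq> i"
    proof (cases "Suc i + k < ?l")
      case False
      then have "?j = Suc i + k - ?l"
        using i Suc.prems by (simp add: le_mod_geq)
      then show ?thesis using False Suc.prems by simp
    qed simp
    then have "{vs ! ?j, vs ! (Suc ?j mod ?l)} \<noteq> e"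
      using inj_onD[OF inj_on_closed_walk_edges[OF vs(1,2)], of ?j i] i j unfolding e by auto
    moreover have "{vs ! ?j, vs ! (Suc ?j mod ?l)} \<in> E"
      using vs(3) j by (auto simp: closed_walk_edges_def)
    ultimately have "(vs ! ?j, vs ! (Suc ?j mod ?l)) \<in> adjacency (E - {e})"
      by (simp add: adjacency_def)
    moreover have "Suc ?j mod ?l = (Suc i + Suc k) mod ?l"
      by (simp add: mod_Suc_eq)
    ultimately show ?case
      using Suc by (auto intro: rtrancl_into_rtrancl)
  qed
  have "Suc i + (?l - 1) = i + ?l"
    using i by simp
  then have "(Suc i + (?l - 1)) mod ?l = i"
    using i by simp
  then have detour: "(vs ! (Suc i mod ?l), vs ! i) \<in> ?R"
    using walk[of "?l - 1"] i by simp
  have "adjacency E \<subseteq> ?R"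
  proof
    fix p assume p: "p \<in> adjacency E"
    obtain x y where xy: "p = (x, y)" by (cases p)
    show "p \<in> ?R"
    proof (cases "{x, y} = e")
      case True
      then show ?thesis
        using detour symD[OF sym_rtrancl[OF sym_adjacency] detour] by (auto simp: xy e doubleton_eq_iff)
    next
      case False
      then show ?thesis using p by (auto simp: xy adjacency_def)
    qed
  qed
  then have "(adjacency E)\<^sup>* \<subseteq> ?R"
    by (rule rtrancl_subset_rtrancl)
  then show ?thesis
    using conn by (auto simp: connected_graph_def)
qed

text \<open>The only cycle passes through \<open>e\<close>, so none survives the deletion, while
  connectedness is kept by the detour along the cycle.\<close>

lemma is_tree_delete_cycle_edge:
  assumes "simple_graph V E" "connected_graph V E" "cycles E = {C}" "e \<in> C"
  shows "is_tree V (E - {e})"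
proof -
  have "C \<notin> cycles (E - {e})"
    using assms(4) by (auto simp: cycles_def)
  then have "cycles (E - {e}) = {}"
    using cycles_mono[of "E - {e}" E] assms(3) by auto
  moreover have "connected_graph V (E - {e})"
    using connected_graph_delete_cycle_edge assms by blast
  ultimately show ?thesis
    using assms(1) by (auto simp: is_tree_def simple_graph_def)
qed

section \<open>Faces and number of edges of a unicyclic graph\<close>

text \<open>Being a cycle depends only on the edges used, so a tree cannot contain \<open>C\<close>.
  Conversely, if \<open>F\<close> misses some \<open>e\<close> in \<open>C\<close>, the spanning
  tree \<open>E - {e}\<close> lies above \<open>F\<close>.\<close>

lemma spanning_complex_unicyclic:
  assumes "simple_graph V E" "connected_graph V E" "cycles E = {C}"
  shows "spanning_complex V E = {F. F \<subseteq> E \<and> \<not> C \<subseteq> F}"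
proof (intro equalityI subsetI)
  fix F assume "F \<in> spanning_complex V E"
  then obtain T where T: "T \<subseteq> E" "cycles T = {}" "F \<subseteq> T"
    by (auto simp: spanning_complex_def spanning_trees_def is_tree_def)
  have "\<not> C \<subseteq> T"
  proof
    assume "C \<subseteq> T"
    moreover have "C \<in> cycles E" using assms by simp
    ultimately have "C \<in> cycles T" by (auto simp: cycles_def)
    then show False using T by simp
  qed
  then show "F \<in> {F. F \<subseteq> E \<and> \<not> C \<subseteq> F}" using T by blast
next
  fix F assume F: "F \<in> {F. F \<subseteq> E \<and> \<not> C \<subseteq> F}"
  then obtain e where "e \<in> C" "e \<notin> F" by blast
  then have "F \<subseteq> E - {e}" "E - {e} \<in> spanning_trees V E"
    using F is_tree_delete_cycle_edge[OF assms] by (auto simp: spanning_trees_def)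
  then show "F \<in> spanning_complex V E"
    by (auto simp: spanning_complex_def)
qed

text \<open>The count comes from the tree left after deleting one edge of \<open>C\<close>. The
  bound \<open>3 \<le> card C\<close> supplies such an edge; later it makes the empty set a face and
  gives \<open>2 \<le> m\<close>.\<close>

lemma unicyclic_card_edges:
  assumes "simple_graph V E" "connected_graph V E" "cycles E = {C}"
  shows "card E = card V" and "finite E" and "C \<subseteq> E" and "3 \<le> card C"
proof -
  have "C \<in> cycles E" using assms by simp
  then show CE: "C \<subseteq> E" and C3: "3 \<le> card C"
    by (auto simp: cycles_def card_closed_walk_edges)
  show fin: "finite E"
    using simplicial_complex_spanning_complex[OF assms(1)] by (simp add: simplicial_complex_def)
  obtain e where e: "e \<in> C" using C3 by fastforce
  show "card E = card V"
    using tree_card_edges[OF is_tree_delete_cycle_edge[OF assms e]] e CE fin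
    by (metis card_Suc_Diff1 subsetD)
qed

section \<open>Hilbert series of Stanley-Reisner rings\<close>

lemma mpoly_ring_simps [simp]:
  "monoid.mult (mpoly_ring X) = (*)" "one (mpoly_ring X) = 1"
  "zero (mpoly_ring X) = 0" "add (mpoly_ring X) = (+)"
  "p \<in> carrier (mpoly_ring X) \<longleftrightarrow> (\<forall>a\<in>Poly_Mapping.keys p. Poly_Mapping.keys a \<subseteq> X)"
  by (simp_all add: mpoly_ring_def)

lemma poly_mapping_sum_single:
  "p = (\<Sum>a\<in>Poly_Mapping.keys p. Poly_Mapping.single a (Poly_Mapping.lookup p a))"
proof (rule poly_mapping_eqI)
  fix k
  show "Poly_Mapping.lookup p k =
    Poly_Mapping.lookup (\<Sum>a\<in>Poly_Mapping.keys p. Poly_Mapping.single a (Poly_Mapping.lookup p a)) k"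
    by (auto simp: lookup_sum lookup_single when_def in_keys_iff)
qed

lemma keys_add_nat:
  fixes a b :: "'x \<Rightarrow>\<^sub>0 nat"
  shows "Poly_Mapping.keys (a + b) = Poly_Mapping.keys a \<union> Poly_Mapping.keys b"
  by (auto simp: in_keys_iff lookup_add)

text \<open>For finite \<open>F\<close> the exponent vector is the indicator function of
  \<open>F\<close>. For infinite \<open>F\<close> the default values of product and sum make both
  sides 1.\<close>

lemma face_monomial_eq_single:
  "face_monomial F = Poly_Mapping.single (\<Sum>x\<in>F. Poly_Mapping.single x 1) 1"
  unfolding face_monomial_def
  by (induction F rule: infinite_finite_induct) (auto simp: mult_single)

lemma keys_sum_single_one:
  assumes "finite F"
  shows "Poly_Mapping.keys (\<Sum>x\<in>F. Poly_Mapping.single x (1::nat)) = F"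
  using assms by (induction F) (auto simp: keys_add_nat)

text \<open>Multiplication by a monomial only enlarges supports, and supersets of non-faces are
  non-faces; so the right-hand side is an ideal, and it contains the generators. Conversely, a
  monomial whose support is a non-face \<open>F\<close> is a multiple of
  \<open>face_monomial F\<close>.\<close>

lemma SR_ideal_eq:
  assumes cplx: "simplicial_complex X \<Delta>"
  shows "SR_ideal X \<Delta> = {p :: ('x, 'k::field) mpoly.
    \<forall>a\<in>Poly_Mapping.keys p. Poly_Mapping.keys a \<subseteq> X \<and> Poly_Mapping.keys a \<notin> \<Delta>}"
    (is "_ = ?J")
proof
  have fin: "finite X" and down: "\<And>F G. F \<in> \<Delta> \<Longrightarrow> G \<subseteq> F \<Longrightarrow> G \<in> \<Delta>"
    using cplx by (auto simp: simplicial_complex_def)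
  interpret cring "mpoly_ring X :: ('x, 'k) mpoly ring" by (rule cring_mpoly_ring)
  interpret I: ideal "SR_ideal X \<Delta> :: ('x, 'k) mpoly set" "mpoly_ring X" by (rule ideal_SR_ideal)
  have add_J: "p + q \<in> ?J" if "p \<in> ?J" "q \<in> ?J" for p q :: "('x, 'k) mpoly"
    using that Poly_Mapping.keys_add[of p q] by blast
  have mult_J: "q * p \<in> ?J" if "p \<in> ?J" "q \<in> carrier (mpoly_ring X)" for p q :: "('x, 'k) mpoly"
  proof clarify
    fix a assume "a \<in> Poly_Mapping.keys (q * p)"
    then obtain b c where "a = b + c" "b \<in> Poly_Mapping.keys q" "c \<in> Poly_Mapping.keys p"
      using Poly_Mapping.keys_mult by blast
    then show "Poly_Mapping.keys a \<subseteq> X \<and> Poly_Mapping.keys a \<notin> \<Delta>"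
      using that down[of "Poly_Mapping.keys a" "Poly_Mapping.keys c"] by (auto simp: keys_add_nat)
  qed
  have "ideal ?J (mpoly_ring X)"
  proof (rule idealI)
    show "ring (mpoly_ring X :: ('x, 'k) mpoly ring)" by (rule ring_axioms)
    show "subgroup ?J (add_monoid (mpoly_ring X))"
    proof (rule add.subgroupI)
      fix p assume p: "p \<in> ?J"
      then have "- p \<in> ?J" by simp
      moreover have "\<ominus>\<^bsub>mpoly_ring X\<^esub> p = - p"
        using p by (intro minus_equality) auto
      ultimately show "\<ominus>\<^bsub>mpoly_ring X\<^esub> p \<in> ?J" by simp
    next
      have "0 \<in> ?J" by simp
      then show "?J \<noteq> {}" by blast
    next
      show "?J \<subseteq> carrier (mpoly_ring X)" by auto
    next
      fix p q :: "('x, 'k) mpoly" assume "p \<in> ?J" "q \<in> ?J"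
      then show "p \<oplus>\<^bsub>mpoly_ring X\<^esub> q \<in> ?J"
        using add_J by (simp only: mpoly_ring_simps(4))
    qed
  next
    fix p q :: "('x, 'k) mpoly" assume "p \<in> ?J" "q \<in> carrier (mpoly_ring X)"
    then show "q \<otimes>\<^bsub>mpoly_ring X\<^esub> p \<in> ?J" "p \<otimes>\<^bsub>mpoly_ring X\<^esub> q \<in> ?J"
      using mult_J[of p q] by (simp_all only: mpoly_ring_simps(1) mult.commute[of p q])
  qed
  moreover have "{face_monomial F | F. F \<subseteq> X \<and> F \<notin> \<Delta>} \<subseteq> ?J"
  proof clarify
    fix F a assume F: "F \<subseteq> X" "F \<notin> \<Delta>"
      and "a \<in> Poly_Mapping.keys (face_monomial F :: ('x, 'k) mpoly)"
    then have "Poly_Mapping.keys a = F"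
      using finite_subset[OF F(1) fin]
      by (simp add: face_monomial_eq_single keys_sum_single_one del: One_nat_def)
    then show "Poly_Mapping.keys a \<subseteq> X \<and> Poly_Mapping.keys a \<notin> \<Delta>" using F by simp
  qed
  ultimately show "SR_ideal X \<Delta> \<subseteq> ?J"
    unfolding SR_ideal_def by (rule genideal_minimal)
  have monomial: "Poly_Mapping.single a c \<in> SR_ideal X \<Delta>"
    if a: "Poly_Mapping.keys a \<subseteq> X" "Poly_Mapping.keys a \<notin> \<Delta>" for a and c :: 'k
  proof -
    let ?F = "Poly_Mapping.keys a"
    let ?s = "\<Sum>x\<in>?F. Poly_Mapping.single x (1::nat)"
    \<comment> \<open>Subtraction of exponents is truncated, but here it is exact: \<open>?s\<close>
      is the indicator of the support of \<open>a\<close>, where all exponents are at least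
      1.\<close>
    have s: "a = (a - ?s) + ?s"
    proof (rule poly_mapping_eqI)
      fix x
      have "Poly_Mapping.lookup ?s x = (if x \<in> ?F then 1 else 0)"
        by (simp add: lookup_sum lookup_single when_def)
      then show "Poly_Mapping.lookup a x = Poly_Mapping.lookup (a - ?s + ?s) x"
        by (simp add: lookup_add lookup_minus in_keys_iff del: One_nat_def)
    qed
    have "Poly_Mapping.keys (a - ?s) \<subseteq> X"
      using a s by (metis Un_upper1 dual_order.trans keys_add_nat)
    then have "Poly_Mapping.single (a - ?s) c \<in> carrier (mpoly_ring X)"
      by simp
    moreover have "(face_monomial ?F :: ('x, 'k) mpoly) \<in> SR_ideal X \<Delta>"
    proof -
      have "{face_monomial F | F. F \<subseteq> X \<and> F \<notin> \<Delta>} \<subseteq> carrier (mpoly_ring X :: ('x, 'k) mpoly ring)"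
        using face_monomial_in_carrier by blast
      from genideal_self[OF this] show ?thesis
        unfolding SR_ideal_def using a by blast
    qed
    ultimately have "Poly_Mapping.single (a - ?s) c * face_monomial ?F \<in> SR_ideal X \<Delta>"
      using I.I_l_closed by fastforce
    then show ?thesis
      using s by (simp add: face_monomial_eq_single mult_single)
  qed
  show "?J \<subseteq> SR_ideal X \<Delta>"
  proof
    fix p assume p: "p \<in> ?J"
    \<comment> \<open>The polynomial \<open>p\<close> stays fixed and the induction runs over
      subsets of its support; the full support gives back \<open>p\<close>.\<close>
    have "(\<Sum>a\<in>A. Poly_Mapping.single a (Poly_Mapping.lookup p a)) \<in> SR_ideal X \<Delta>"
      if "A \<subseteq> Poly_Mapping.keys p" for A
      using finite_subset[OF that finite_keys] that
    proof (induction A)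
      case empty
      then show ?case using I.zero_closed by simp
    next
      case (insert a A)
      then show ?case using I.a_closed monomial p by simp
    qed
    then show "p \<in> SR_ideal X \<Delta>"
      by (subst poly_mapping_sum_single) simp
  qed
qed

section \<open>The base field and dimensions in the quotient ring\<close>

lemma subfield_scalars: "subfield (scalars :: ('x, 'k::field) mpoly set) (mpoly_ring X)"
proof -
  interpret cring "mpoly_ring X :: ('x, 'k) mpoly ring" by (rule cring_mpoly_ring)
  let ?S = "scalars :: ('x, 'k) mpoly set"
  have carr: "?S \<subseteq> carrier (mpoly_ring X)"
    by (auto simp: scalars_def)
  have a_inv: "\<ominus>\<^bsub>mpoly_ring X\<^esub> p = - p" if "p \<in> ?S" for p
    using subsetD[OF carr that] by (intro minus_equality) auto
  have "subring ?S (mpoly_ring X)"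
  proof (rule subringI)
    show "\<one>\<^bsub>mpoly_ring X\<^esub> \<in> ?S"
      by (auto simp: scalars_def intro: exI[of _ 1])
    fix p q assume pq: "p \<in> ?S" "q \<in> ?S"
    then obtain c d where cd: "p = Poly_Mapping.single 0 c" "q = Poly_Mapping.single 0 d"
      by (auto simp: scalars_def)
    show "p \<otimes>\<^bsub>mpoly_ring X\<^esub> q \<in> ?S" "p \<oplus>\<^bsub>mpoly_ring X\<^esub> q \<in> ?S"
      "\<ominus>\<^bsub>mpoly_ring X\<^esub> p \<in> ?S"
      unfolding a_inv[OF pq(1)] by (auto simp: cd scalars_def mult_single simp flip: single_add single_uminus)
  qed (fact carr)
  then have sub: "subcring ?S (mpoly_ring X)"
    by (rule subcringI) (simp add: mult.commute)
  show ?thesis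
  proof (rule subfieldI[OF sub], intro equalityI subsetI)
    fix p assume "p \<in> Units (mpoly_ring X\<lparr>carrier := ?S\<rparr>)"
    then obtain q where "p \<in> ?S" "q * p = 1" by (auto simp: Units_def)
    then show "p \<in> ?S - {\<zero>\<^bsub>mpoly_ring X\<^esub>}" by auto
  next
    fix p assume "p \<in> ?S - {\<zero>\<^bsub>mpoly_ring X\<^esub>}"
    then obtain c where c: "p = Poly_Mapping.single 0 c" "c \<noteq> 0"
      by (auto simp: scalars_def) (metis single_zero)
    have "Poly_Mapping.single 0 (inverse c) \<in> ?S" "Poly_Mapping.single 0 (inverse c) * p = 1"
      "p * Poly_Mapping.single 0 (inverse c) = 1" "p \<in> ?S"
      using c by (auto simp: scalars_def mult_single)
    then show "p \<in> Units (mpoly_ring X\<lparr>carrier := ?S\<rparr>)"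
      by (auto simp: Units_def)
  qed
qed

lemma SR_proj_eq_iff:
  fixes p q :: "('x, 'k::field) mpoly"
  assumes "p \<in> carrier (mpoly_ring X)" "q \<in> carrier (mpoly_ring X)"
  shows "SR_proj X \<Delta> p = SR_proj X \<Delta> q \<longleftrightarrow> p - q \<in> SR_ideal X \<Delta>"
proof -
  interpret cring "mpoly_ring X :: ('x, 'k) mpoly ring" by (rule cring_mpoly_ring)
  have "\<ominus>\<^bsub>mpoly_ring X\<^esub> q = - q"
    using assms by (intro minus_equality) auto
  then show ?thesis
    using quotient_eq_iff_same_a_r_cos[OF ideal_SR_ideal assms, of \<Delta>]
    by (simp add: SR_proj_def a_minus_def)
qed

lemma ring_hom_SR_proj:
  "ring_hom_ring (mpoly_ring X) (SR_ring X \<Delta>) (SR_proj X \<Delta> :: ('x, 'k::field) mpoly \<Rightarrow> _)"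
  using ideal.rcos_ring_hom_ring[OF ideal_SR_ideal]
  unfolding SR_ring_def SR_proj_def[abs_def] .

text \<open>A ring homomorphism maps a field onto a field as soon as 1 and 0 have different images.
  The monomial 1 has empty support, a face, so it lies outside the ideal.\<close>

lemma subfield_SR_scalars:
  assumes "simplicial_complex X \<Delta>" "{} \<in> \<Delta>"
  shows "subfield (SR_scalars X \<Delta> :: ('x, 'k::field) mpoly set set) (SR_ring X \<Delta>)"
proof -
  interpret h: ring_hom_ring "mpoly_ring X :: ('x, 'k) mpoly ring" "SR_ring X \<Delta>" "SR_proj X \<Delta>"
    by (rule ring_hom_SR_proj)
  have "SR_proj X \<Delta> (1 :: ('x, 'k) mpoly) \<noteq> SR_proj X \<Delta> 0"
    using assms by (subst SR_proj_eq_iff) (auto simp: SR_ideal_eq simplicial_complex_def)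
  then have "\<one>\<^bsub>SR_ring X \<Delta>\<^esub> \<noteq> (\<zero>\<^bsub>SR_ring X \<Delta>\<^esub> :: ('x, 'k) mpoly set)"
    using h.hom_one h.hom_zero by simp
  then show ?thesis
    unfolding SR_scalars_def by (rule h.img_is_subfield(2)[OF subfield_scalars])
qed

text \<open>Induction on \<open>B\<close>: each further monomial \<open>a\<close> extends the span
  by a line, as its class is not in the span of the earlier ones. So monomials with face support
  stay linearly independent in the quotient.\<close>

lemma dimension_SR_proj_span:
  fixes B :: "('x \<Rightarrow>\<^sub>0 nat) set"
  assumes cplx: "simplicial_complex X \<Delta>" and "finite B"
    and B: "\<And>a. a \<in> B \<Longrightarrow> Poly_Mapping.keys a \<in> \<Delta>"
  shows "ring.dimension (SR_ring X \<Delta>) (card B) (SR_scalars X \<Delta>)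
    (SR_proj X \<Delta> ` {p :: ('x, 'k::field) mpoly. Poly_Mapping.keys p \<subseteq> B})"
  using assms(2,3)
proof (induction B)
  interpret h: ring_hom_ring "mpoly_ring X :: ('x, 'k) mpoly ring" "SR_ring X \<Delta>" "SR_proj X \<Delta>"
    by (rule ring_hom_SR_proj)
  {
    case empty
    have "SR_proj X \<Delta> ` {p :: ('x, 'k) mpoly. Poly_Mapping.keys p \<subseteq> {}} = {\<zero>\<^bsub>SR_ring X \<Delta>\<^esub>}"
      using h.hom_zero by simp
    then show ?case
      using h.S.dimension.zero_dim by simp
  next
    case (insert a B)
    let ?P = "\<lambda>B. {p :: ('x, 'k) mpoly. Poly_Mapping.keys p \<subseteq> B}"
    let ?a = "Poly_Mapping.single a 1 :: ('x, 'k) mpoly"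
    have X: "\<And>F. F \<in> \<Delta> \<Longrightarrow> F \<subseteq> X"
      using cplx by (auto simp: simplicial_complex_def)
    have carr: "p \<in> carrier (mpoly_ring X)" if "p \<in> ?P (insert a B)" for p
      using that insert.prems X by fastforce
    have carrB: "p \<in> carrier (mpoly_ring X)" if "p \<in> ?P B" for p
      using that carr[of p] by blast
    have a_carr: "?a \<in> carrier (mpoly_ring X)"
      by (rule carr) simp
    have scal: "Poly_Mapping.single 0 c \<in> carrier (mpoly_ring X)" for c :: 'k
      by simp
    \<comment> \<open>As \<open>a \<notin> B\<close>, the monomial \<open>a\<close> survives in
      \<open>?a - p\<close>; its support is a face, so the difference cannot lie in the
      ideal.\<close>
    have new: "SR_proj X \<Delta> ?a \<notin> SR_proj X \<Delta> ` ?P B"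
    proof
      assume "SR_proj X \<Delta> ?a \<in> SR_proj X \<Delta> ` ?P B"
      then obtain p where p: "p \<in> ?P B" "SR_proj X \<Delta> ?a = SR_proj X \<Delta> p" by blast
      then have "?a - p \<in> SR_ideal X \<Delta>"
        using SR_proj_eq_iff[OF a_carr carrB[OF p(1)]] by simp
      moreover have "a \<in> Poly_Mapping.keys (?a - p)"
      proof -
        have "a \<notin> Poly_Mapping.keys p" using p(1) insert.hyps(2) by blast
        then show ?thesis by (simp add: in_keys_iff lookup_minus)
      qed
      ultimately show False
        using insert.prems[of a] by (auto simp: SR_ideal_eq[OF cplx])
    qed
    \<comment> \<open>This carries the elements of the line extension back to polynomials, where
      multiplying \<open>?a\<close> by the constant \<open>c\<close> gives
      \<open>single a c\<close>.\<close>
    have comb: "SR_proj X \<Delta> (Poly_Mapping.single 0 c) \<otimes>\<^bsub>SR_ring X \<Delta>\<^esub> SR_proj X \<Delta> ?a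
        \<oplus>\<^bsub>SR_ring X \<Delta>\<^esub> SR_proj X \<Delta> p = SR_proj X \<Delta> (Poly_Mapping.single a c + p)"
      if "p \<in> ?P B" for c p
    proof -
      have "Poly_Mapping.single a c = Poly_Mapping.single 0 c \<otimes>\<^bsub>mpoly_ring X\<^esub> ?a"
        by (simp add: mult_single)
      moreover have "Poly_Mapping.single a c + p = Poly_Mapping.single a c \<oplus>\<^bsub>mpoly_ring X\<^esub> p"
        by simp
      ultimately show ?thesis
        using h.hom_mult[OF scal a_carr] h.hom_add[OF h.R.m_closed[OF scal a_carr] carrB[OF that]]
        by metis
    qed
    have "h.S.line_extension (SR_scalars X \<Delta>) (SR_proj X \<Delta> ?a) (SR_proj X \<Delta> ` ?P B)
        = {SR_proj X \<Delta> (Poly_Mapping.single a c + p) | c p. p \<in> ?P B}"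
    proof (rule Set.set_eqI)
      fix u
      have "u \<in> h.S.line_extension (SR_scalars X \<Delta>) (SR_proj X \<Delta> ?a) (SR_proj X \<Delta> ` ?P B) \<longleftrightarrow>
        (\<exists>c. \<exists>p\<in>?P B. u = SR_proj X \<Delta> (Poly_Mapping.single 0 c) \<otimes>\<^bsub>SR_ring X \<Delta>\<^esub> SR_proj X \<Delta> ?a
          \<oplus>\<^bsub>SR_ring X \<Delta>\<^esub> SR_proj X \<Delta> p)"
        unfolding h.S.line_extension_mem_iff SR_scalars_def scalars_def by blast
      also have "\<dots> \<longleftrightarrow> u \<in> {SR_proj X \<Delta> (Poly_Mapping.single a c + p) | c p. p \<in> ?P B}"
        using comb by auto
      finally show "u \<in> h.S.line_extension (SR_scalars X \<Delta>) (SR_proj X \<Delta> ?a) (SR_proj X \<Delta> ` ?P B) \<longleftrightarrow>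
        u \<in> {SR_proj X \<Delta> (Poly_Mapping.single a c + p) | c p. p \<in> ?P B}" .
    qed
    also have "\<dots> = SR_proj X \<Delta> ` {Poly_Mapping.single a c + p | c p. p \<in> ?P B}"
      by blast
    also have "{Poly_Mapping.single a c + p | c p. p \<in> ?P B} = ?P (insert a B)"
    proof (intro equalityI subsetI)
      fix q assume "q \<in> {Poly_Mapping.single a c + p | c p. p \<in> ?P B}"
      then obtain c p where q: "q = Poly_Mapping.single a c + p" "Poly_Mapping.keys p \<subseteq> B" by blast
      have "Poly_Mapping.keys (Poly_Mapping.single a c) \<subseteq> {a}" by simp
      then show "q \<in> ?P (insert a B)"
        using q Poly_Mapping.keys_add[of "Poly_Mapping.single a c" p] by blast
    next
      fix q assume q: "q \<in> ?P (insert a B)"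
      let ?c = "Poly_Mapping.lookup q a"
      have "q - Poly_Mapping.single a ?c \<in> ?P B"
        using q by (auto simp: in_keys_iff lookup_minus lookup_single when_def split: if_splits)
      moreover have "q = Poly_Mapping.single a ?c + (q - Poly_Mapping.single a ?c)" by simp
      ultimately show "q \<in> {Poly_Mapping.single a c + p | c p. p \<in> ?P B}" by blast
    qed
    finally have "SR_proj X \<Delta> ` ?P (insert a B) =
      h.S.line_extension (SR_scalars X \<Delta>) (SR_proj X \<Delta> ?a) (SR_proj X \<Delta> ` ?P B)" by simp
    moreover have "h.S.dimension (card B) (SR_scalars X \<Delta>) (SR_proj X \<Delta> ` ?P B)"
      using insert by blast
    ultimately show ?case
      using h.S.dimension.Suc_dim[OF h.hom_closed[OF a_carr] new] insert.hyps by simp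
  }
qed

section \<open>Graded components and counting monomials by support\<close>

text \<open>The support is exactly \<open>F\<close> rather than contained in \<open>F\<close>, so
  that different faces give disjoint sets of monomials.\<close>

definition monomials_on :: "'x set \<Rightarrow> nat \<Rightarrow> ('x \<Rightarrow>\<^sub>0 nat) set" where
  "monomials_on F j = {a. Poly_Mapping.keys a = F \<and> monom_degree a = j}"

text \<open>The terms of a homogeneous polynomial whose support is not a face lie in the ideal, so
  dropping them (\<open>q\<close> in the proof) does not change the class.\<close>

lemma SR_component_eq:
  assumes "simplicial_complex X \<Delta>"
  shows "SR_component X \<Delta> j = SR_proj X \<Delta> `
    {p :: ('x, 'k::field) mpoly. Poly_Mapping.keys p \<subseteq> (\<Union>F\<in>\<Delta>. monomials_on F j)}"
proof (intro equalityI subsetI)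
  have X: "\<And>F. F \<in> \<Delta> \<Longrightarrow> F \<subseteq> X"
    using assms by (auto simp: simplicial_complex_def)
  let ?B = "\<Union>F\<in>\<Delta>. monomials_on F j"
  {
    fix u :: "('x, 'k) mpoly set" assume "u \<in> SR_component X \<Delta> j"
    then obtain p where p: "u = SR_proj X \<Delta> p" "p \<in> carrier (mpoly_ring X)"
      and deg: "\<And>a. a \<in> Poly_Mapping.keys p \<Longrightarrow> monom_degree a = j"
      by (auto simp: SR_component_def homogeneous_def)
    define q where "q = (\<Sum>a\<in>Poly_Mapping.keys p \<inter> ?B. Poly_Mapping.single a (Poly_Mapping.lookup p a))"
    have q: "Poly_Mapping.lookup q a = (if a \<in> ?B then Poly_Mapping.lookup p a else 0)" for a
      by (auto simp: q_def lookup_sum lookup_single when_def in_keys_iff)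
    have keys_q: "Poly_Mapping.keys q \<subseteq> ?B" "Poly_Mapping.keys q \<subseteq> Poly_Mapping.keys p"
      by (auto simp: in_keys_iff q split: if_splits)
    have keys_diff: "a \<in> Poly_Mapping.keys p" "a \<notin> ?B" if "a \<in> Poly_Mapping.keys (p - q)" for a
      using that by (auto simp: in_keys_iff lookup_minus q split: if_splits)
    have "p - q \<in> SR_ideal X \<Delta>"
      unfolding SR_ideal_eq[OF assms]
    proof clarify
      fix a assume a: "a \<in> Poly_Mapping.keys (p - q)"
      show "Poly_Mapping.keys a \<subseteq> X \<and> Poly_Mapping.keys a \<notin> \<Delta>"
        using keys_diff[OF a] deg p(2) by (auto simp: monomials_on_def)
    qed
    moreover have "q \<in> carrier (mpoly_ring X)"
      using p(2) keys_q(2) by auto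
    ultimately have "u = SR_proj X \<Delta> q"
      using p SR_proj_eq_iff by blast
    then show "u \<in> SR_proj X \<Delta> ` {p. Poly_Mapping.keys p \<subseteq> ?B}"
      using keys_q by blast
  next
    fix u :: "('x, 'k) mpoly set" assume "u \<in> SR_proj X \<Delta> ` {p. Poly_Mapping.keys p \<subseteq> ?B}"
    then obtain p where p: "u = SR_proj X \<Delta> p" "Poly_Mapping.keys p \<subseteq> ?B" by blast
    then have "p \<in> homogeneous X j"
      using X by (fastforce simp: homogeneous_def monomials_on_def)
    then show "u \<in> SR_component X \<Delta> j"
      using p by (auto simp: SR_component_def)
  }
qed

lemma monom_degree_add: "monom_degree (a + b) = monom_degree a + monom_degree b"
proof -
  let ?S = "Poly_Mapping.keys a \<union> Poly_Mapping.keys b"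
  have deg: "monom_degree c = (\<Sum>x\<in>?S. Poly_Mapping.lookup c x)"
    if "Poly_Mapping.keys c \<subseteq> ?S" for c
    unfolding monom_degree_def using that by (intro sum.mono_neutral_left) (auto simp: in_keys_iff)
  show ?thesis
    using deg[of "a + b"] deg[of a] deg[of b] by (simp add: keys_add_nat lookup_add sum.distrib)
qed

lemma monom_degree_single [simp]: "monom_degree (Poly_Mapping.single x i) = i"
  by (simp add: monom_degree_def)

lemma monomials_on_empty: "monomials_on {} j = (if j = 0 then {0} else {})"
  by (auto simp: monomials_on_def monom_degree_def)

text \<open>Sort by the exponent \<open>i\<close> of \<open>x\<close>, which is at least 1 because
  \<open>x\<close> belongs to the support.\<close>

lemma monomials_on_insert:
  assumes "x \<notin> F"
  shows "monomials_on (insert x F) j =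
    (\<Union>i\<in>{1..j}. (\<lambda>b. Poly_Mapping.single x i + b) ` monomials_on F (j - i))"
proof (intro equalityI subsetI)
  fix a assume a: "a \<in> monomials_on (insert x F) j"
  let ?i = "Poly_Mapping.lookup a x"
  \<comment> \<open>Resetting the exponent of \<open>x\<close> to 0 divides out the power of
    \<open>x\<close>.\<close>
  let ?b = "Poly_Mapping.update x 0 a"
  have eq: "a = Poly_Mapping.single x ?i + ?b"
    by (rule poly_mapping_eqI) (simp add: lookup_add lookup_single lookup_update when_def)
  have "j = monom_degree (Poly_Mapping.single x ?i + ?b)"
    using a eq by (simp add: monomials_on_def)
  then have "j = ?i + monom_degree ?b"
    by (simp add: monom_degree_add)
  moreover have "?i \<noteq> 0"
    using a unfolding in_keys_iff[symmetric] by (simp add: monomials_on_def)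
  moreover have "Poly_Mapping.keys ?b = F"
    using a assms by (auto simp: monomials_on_def keys_update)
  ultimately have "?i \<in> {1..j}" "?b \<in> monomials_on F (j - ?i)"
    by (auto simp: monomials_on_def)
  then show "a \<in> (\<Union>i\<in>{1..j}. (\<lambda>b. Poly_Mapping.single x i + b) ` monomials_on F (j - i))"
    using eq by blast
qed (auto simp: monomials_on_def keys_add_nat monom_degree_add)

lemma finite_monomials_on: "finite F \<Longrightarrow> finite (monomials_on F j)"
  by (induction F arbitrary: j rule: finite_induct) (auto simp: monomials_on_empty monomials_on_insert)

lemma card_monomials_on_insert:
  assumes "finite F" "x \<notin> F"
  shows "card (monomials_on (insert x F) j) = (\<Sum>i = 1..j. card (monomials_on F (j - i)))"
proof -
  let ?M = "\<lambda>i. (\<lambda>b. Poly_Mapping.single x i + b) ` monomials_on F (j - i)"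
  \<comment> \<open>Because \<open>x \<notin> F\<close>, the piece containing \<open>a\<close> is
    determined by the exponent of \<open>x\<close>; hence the pieces are disjoint.\<close>
  have lookup: "Poly_Mapping.lookup a x = i" if "a \<in> ?M i" for a i
    using that assms(2) by (auto simp: monomials_on_def lookup_add in_keys_iff)
  have "card (monomials_on (insert x F) j) = (\<Sum>i = 1..j. card (?M i))"
    unfolding monomials_on_insert[OF assms(2)]
  proof (intro card_UN_disjoint ballI impI)
    fix i k :: nat assume ik: "i \<noteq> k"
    show "?M i \<inter> ?M k = {}"
    proof (rule equals0I)
      fix a assume "a \<in> ?M i \<inter> ?M k"
      then show False using ik lookup[of a i] lookup[of a k] by simp
    qed
  qed (simp_all add: finite_monomials_on assms(1))
  also have "\<dots> = (\<Sum>i = 1..j. card (monomials_on F (j - i)))"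
    by (simp add: card_image inj_on_def)
  finally show ?thesis .
qed

text \<open>The series \<open>t / (1 - t)\<close> counts the positive powers of a single variable by
  degree.\<close>

lemma fps_X_over_one_minus_X_nth:
  "fps_nth (fps_X / (1 - fps_X) :: rat fps) i = (if i = 0 then 0 else 1)"
  by (simp add: fps_divide_unit fps_inverse_one_minus_fps_X)

text \<open>Each variable in \<open>F\<close> carries its own positive exponent, which contributes a
  factor \<open>t / (1 - t)\<close>. The recursion for inserting a variable is the Cauchy product
  with this factor.\<close>

lemma fps_card_monomials_on:
  assumes "finite F"
  shows "Abs_fps (\<lambda>j. of_nat (card (monomials_on F j))) = (fps_X / (1 - fps_X) :: rat fps) ^ card F"
  using assms
proof (induction F)
  case empty
  then show ?case by (auto simp: fps_eq_iff monomials_on_empty)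
next
  case (insert x F)
  let ?y = "fps_X / (1 - fps_X) :: rat fps"
  have "of_nat (card (monomials_on (insert x F) j)) = fps_nth (?y * ?y ^ card F) j" for j
  proof -
    have "fps_nth (?y * ?y ^ card F) j =
        (\<Sum>i = 0..j. (if i = 0 then 0 else of_nat (card (monomials_on F (j - i)))))"
      unfolding insert.IH[symmetric] fps_mult_nth fps_X_over_one_minus_X_nth
      by (intro sum.cong) auto
    also have "\<dots> = (\<Sum>i = 1..j. of_nat (card (monomials_on F (j - i))))"
      by (intro sum.mono_neutral_cong_right) auto
    also have "\<dots> = of_nat (card (monomials_on (insert x F) j))"
      using insert by (simp add: card_monomials_on_insert)
    finally show ?thesis by simp
  qed
  then show ?case using insert.hyps by (simp add: fps_eq_iff)
qed

text \<open>In each degree the monomials with face support form a basis, and sorting them by support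
  splits the dimension over the faces. The assumption \<open>{} \<in> \<Delta>\<close> excludes the
  zero ring, where the scalars are no field.\<close>

lemma SR_hilbert_series_eq:
  assumes cplx: "simplicial_complex X \<Delta>" and "{} \<in> \<Delta>"
  shows "SR_hilbert_series TYPE('k::field) X \<Delta> = (\<Sum>F\<in>\<Delta>. (fps_X / (1 - fps_X)) ^ card F)"
proof -
  have fX: "finite X" and sub: "\<Delta> \<subseteq> Pow X" using cplx by (auto simp: simplicial_complex_def)
  then have fD: "finite \<Delta>" by (meson finite_Pow_iff finite_subset)
  have fF: "finite F" if "F \<in> \<Delta>" for F using that sub fX by (auto intro: finite_subset)
  have dim: "ring.dim (SR_ring X \<Delta>) (SR_scalars X \<Delta>) (SR_component X \<Delta> j :: (_, 'k) mpoly set set)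
    = (\<Sum>F\<in>\<Delta>. card (monomials_on F j))" for j
  proof -
    interpret h: ring_hom_ring "mpoly_ring X :: (_, 'k) mpoly ring" "SR_ring X \<Delta>" "SR_proj X \<Delta>"
      by (rule ring_hom_SR_proj)
    let ?B = "\<Union>F\<in>\<Delta>. monomials_on F j"
    have "h.S.dimension (card ?B) (SR_scalars X \<Delta>) (SR_component X \<Delta> j)"
      unfolding SR_component_eq[OF cplx]
      by (rule dimension_SR_proj_span[OF cplx])
        (auto simp: fD fF finite_monomials_on, auto simp: monomials_on_def)
    \<comment> \<open>The relation \<open>dimension\<close> determines the number \<open>dim\<close>
      because the scalars form a subfield.\<close>
    then have "h.S.dim (SR_scalars X \<Delta>) (SR_component X \<Delta> j) = card ?B"
      using h.S.dimI[OF subfield_SR_scalars[OF assms]] by (simp add: over_def)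
    also have "\<dots> = (\<Sum>F\<in>\<Delta>. card (monomials_on F j))"
      using fD fF by (intro card_UN_disjoint) (auto simp: finite_monomials_on, auto simp: monomials_on_def)
    finally show ?thesis .
  qed
  show ?thesis
    unfolding SR_hilbert_series_def hilbert_series_def dim
    by (simp add: fps_eq_iff fps_sum_nth fF flip: fps_card_monomials_on)
qed

section \<open>Counting the faces\<close>

lemma sum_Pow_card:
  fixes g :: "nat \<Rightarrow> 'a::comm_semiring_1"
  assumes "finite A"
  shows "(\<Sum>F\<in>Pow A. g (card F)) = (\<Sum>k\<le>card A. of_nat (card A choose k) * g k)"
proof -
  have "(\<Sum>F\<in>Pow A. g (card F)) = (\<Sum>k\<le>card A. \<Sum>F\<in>{F \<in> Pow A. card F = k}. g (card F))"
    using assms by (intro sum.group[symmetric]) (auto intro: card_mono)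
  also have "\<dots> = (\<Sum>k\<le>card A. of_nat (card A choose k) * g k)"
  proof (rule sum.cong[OF refl])
    fix k
    have "(\<Sum>F\<in>{F \<in> Pow A. card F = k}. g (card F)) = of_nat (card {F \<in> Pow A. card F = k}) * g k"
      by simp
    then show "(\<Sum>F\<in>{F \<in> Pow A. card F = k}. g (card F)) = of_nat (card A choose k) * g k"
      using n_subsets[OF assms, of k] by simp
  qed
  finally show ?thesis .
qed

text \<open>Removing \<open>C\<close> is a bijection from the supersets of \<open>C\<close> in
  \<open>A\<close> onto the subsets of \<open>A - C\<close>, with inverse
  \<open>G \<mapsto> C \<union> G\<close>.\<close>

lemma sum_supersets_card:
  fixes g :: "nat \<Rightarrow> 'a::comm_semiring_1"
  assumes "finite A" "C \<subseteq> A"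
  shows "(\<Sum>F | F \<subseteq> A \<and> C \<subseteq> F. g (card F)) =
    (\<Sum>k = card C..card A. of_nat (card A - card C choose (k - card C)) * g k)"
proof -
  have "(\<Sum>F | F \<subseteq> A \<and> C \<subseteq> F. g (card F)) = (\<Sum>G\<in>Pow (A - C). g (card C + card G))"
  proof (rule sum.reindex_bij_witness[of _ "\<lambda>G. C \<union> G" "\<lambda>F. F - C"])
    fix F assume F: "F \<in> {F. F \<subseteq> A \<and> C \<subseteq> F}"
    then have "finite F" "finite C" using assms by (auto intro: finite_subset)
    then show "g (card C + card (F - C)) = g (card F)"
      using F card_mono[of F C] by (simp add: card_Diff_subset)
  qed (use assms in auto)
  also have "\<dots> = (\<Sum>k\<le>card (A - C). of_nat (card (A - C) choose k) * g (card C + k))"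
    using assms by (intro sum_Pow_card) simp
  also have "\<dots> = (\<Sum>k\<le>card A - card C. of_nat (card A - card C choose k) * g (card C + k))"
    using assms by (simp add: card_Diff_subset finite_subset)
  also have "\<dots> = (\<Sum>k = card C..card A. of_nat (card A - card C choose (k - card C)) * g k)"
    using card_mono[OF assms]
    by (intro sum.reindex_bij_witness[of _ "\<lambda>k. k - card C" "\<lambda>k. card C + k"]) auto
  finally show ?thesis .
qed

text \<open>Subtract the sets containing \<open>C\<close> from all subsets of \<open>A\<close>. The
  correction starts at size \<open>m\<close>; the empty set yields the summand 1, and the full set
  \<open>A\<close> cancels, so the sizes stop at \<open>n - 1\<close>.\<close>

lemma sum_avoiding_card:
  fixes y :: "'a::comm_ring_1"
  assumes "finite A" "C \<subseteq> A" "card A = n" "card C = m" "2 \<le> m"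
  shows "(\<Sum>F | F \<subseteq> A \<and> \<not> C \<subseteq> F. y ^ card F) =
    (\<Sum>i = 0..m - 2. of_nat (n choose (i + 1)) * y ^ (i + 1))
    + (\<Sum>i = m - 1..n - 2.
        (of_nat (n choose (i + 1)) - of_nat ((n - m) choose (i + 1 - m))) * y ^ (i + 1))
    + 1"
proof -
  have mn: "m \<le> n" using card_mono[OF assms(1,2)] assms by simp
  let ?a = "\<lambda>k. of_nat (n choose k) * y ^ k"
  let ?b = "\<lambda>k. of_nat (n - m choose (k - m)) * y ^ k"
  have split: "Pow A = {F. F \<subseteq> A \<and> \<not> C \<subseteq> F} \<union> {F. F \<subseteq> A \<and> C \<subseteq> F}" by blast
  have "(\<Sum>F\<in>Pow A. y ^ card F) =
      (\<Sum>F | F \<subseteq> A \<and> \<not> C \<subseteq> F. y ^ card F) + (\<Sum>F | F \<subseteq> A \<and> C \<subseteq> F. y ^ card F)"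
    unfolding split using assms(1) by (intro sum.union_disjoint) auto
  then have "(\<Sum>F | F \<subseteq> A \<and> \<not> C \<subseteq> F. y ^ card F) = (\<Sum>k\<le>n. ?a k) - (\<Sum>k = m..n. ?b k)"
    using sum_Pow_card[OF assms(1), of "(^) y"] sum_supersets_card[OF assms(1,2), of "(^) y"] assms
    by (simp add: algebra_simps)
  \<comment> \<open>The sizes 0 and \<open>n\<close> are split off: the first becomes the summand 1,
    the second cancels against the last term of the sum of \<open>?b\<close>.\<close>
  also have "(\<Sum>k\<le>n. ?a k) = 1 + (\<Sum>k = 1..<m. ?a k) + (\<Sum>k = m..<n. ?a k) + y ^ n"
  proof -
    have "{..n} = insert 0 (insert n ({1..<m} \<union> {m..<n}))" using mn assms(5) by auto
    then show ?thesis using mn assms(5) by (simp add: sum.union_disjoint algebra_simps)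
  qed
  also have "(\<Sum>k = m..n. ?b k) = (\<Sum>k = m..<n. ?b k) + y ^ n"
    using mn by (simp add: sum.last_plus algebra_simps)
  finally have "(\<Sum>F | F \<subseteq> A \<and> \<not> C \<subseteq> F. y ^ card F) =
      (\<Sum>k = 1..<m. ?a k) + (\<Sum>k = m..<n. ?a k - ?b k) + 1"
    by (simp add: sum_subtractf)
  \<comment> \<open>Both ranges are shifted by \<open>k = i + 1\<close>. As
    \<open>2 \<le> m \<le> n\<close>, the bounds \<open>m - 2\<close>, \<open>m - 1\<close> and
    \<open>n - 2\<close> are not truncated, and for \<open>m = n\<close> the second sum is
    empty.\<close>
  moreover have "(\<Sum>k = 1..<m. ?a k) = (\<Sum>i = 0..m - 2. ?a (i + 1))"
    using assms(5) by (intro sum.reindex_bij_witness[of _ Suc "\<lambda>k. k - 1"]) auto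
  moreover have "(\<Sum>k = m..<n. ?a k - ?b k) = (\<Sum>i = m - 1..n - 2. ?a (i + 1) - ?b (i + 1))"
    using assms(5) mn by (intro sum.reindex_bij_witness[of _ Suc "\<lambda>k. k - 1"]) auto
  ultimately show ?thesis by (simp add: left_diff_distrib)
qed

theorem theorem3p6:
  fixes V :: "'v set" and E :: "'v set set" and n m :: nat
  assumes "unicyclic_graph n m V E"
  shows "SR_hilbert_series TYPE('k::field) E (spanning_complex V E) =
    (\<Sum>i = 0..m - 2. of_nat (n choose (i + 1)) * fps_X ^ (i + 1) / (1 - fps_X) ^ (i + 1))
    + (\<Sum>i = m - 1..n - 2.
        (of_nat (n choose (i + 1)) - of_nat ((n - m) choose (i + 1 - m)))
          * fps_X ^ (i + 1) / (1 - fps_X) ^ (i + 1))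
    + 1"
proof -
  obtain C where G: "simple_graph V E" "connected_graph V E" "cycles E = {C}"
    and n: "card V = n" and m: "card C = m"
    using assms by (auto simp: unicyclic_graph_def)
  note facts = unicyclic_card_edges[OF G]
  have complex: "spanning_complex V E = {F. F \<subseteq> E \<and> \<not> C \<subseteq> F}"
    by (rule spanning_complex_unicyclic[OF G])
  \<comment> \<open>The constant term of \<open>1 - fps_X\<close> is 1, so division is
    multiplication by its inverse and commutes with powers.\<close>
  have quotient: "c * fps_X ^ k / (1 - fps_X) ^ k = c * (fps_X / (1 - fps_X)) ^ k"
    for c :: "rat fps" and k
    by (simp add: fps_divide_unit fps_inverse_power power_mult_distrib mult.assoc)
  have "C \<noteq> {}" using facts(4) by auto
  then have "{} \<in> spanning_complex V E" by (simp add: complex)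
  then have "SR_hilbert_series TYPE('k) E (spanning_complex V E) =
      (\<Sum>F | F \<subseteq> E \<and> \<not> C \<subseteq> F. (fps_X / (1 - fps_X)) ^ card F)"
    using SR_hilbert_series_eq[OF simplicial_complex_spanning_complex[OF G(1)]] by (simp add: complex)
  also have "\<dots> =
    (\<Sum>i = 0..m - 2. of_nat (n choose (i + 1)) * (fps_X / (1 - fps_X)) ^ (i + 1))
    + (\<Sum>i = m - 1..n - 2.
        (of_nat (n choose (i + 1)) - of_nat ((n - m) choose (i + 1 - m)))
          * (fps_X / (1 - fps_X)) ^ (i + 1))
    + 1"
    using facts n m by (intro sum_avoiding_card) auto
  finally show ?thesis
    unfolding quotient .
qed

end
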